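(* Let $n$ be an integer with $n>4$ such that $n$ is divisible by neither $2$ nor $3$, and let $\zeta=e^{2i\pi/n}$. Then $$\prod_{k=1}^{n-1}\left(1-\zeta^k+\zeta^{2k}\right)=1.$$ Consequently, $1-\zeta+\zeta^2$ is a unit in the ring of integers of $\mathbb{Q}(\zeta)$. *)

theory Defs
  imports
    "HOL-Analysis.Analysis"
    "HOL-Algebra.Generated_Fields"
    "HOL-Computational_Algebra.Polynomial"
    "HOL-Decision_Procs.Algebra_Aux"
begin

definition rat_adjoin :: "complex \<Rightarrow> complex set" where
  "rat_adjoin z = generate_field cring_class_ops (insert z \<rat>)"

definition ring_of_integers :: "complex set \<Rightarrow> complex ring" where
  "ring_of_integers K = cring_class_ops\<lparr>carrier := {x \<in> K. algebraic_int x}\<rparr>"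

end

theory Submission
  imports
    Defs
    "HOL-Number_Theory.Modular_Inverse"
    "Jordan_Normal_Form.Char_Poly"
begin

text \<open>
  For odd \<open>a\<close>, \<open>(1 + x) * (\<Sum>i<a. (- x) ^ i) = 1 + x ^ a\<close>. If \<open>a\<close> is coprime to \<open>n\<close>, then
  \<open>k \<mapsto> a * k\<close> permutes the nonzero residues modulo \<open>n\<close>, so the products of \<open>1 + \<zeta> ^ k\<close> and of
  \<open>1 + \<zeta> ^ (a * k)\<close> agree; neither vanishes for odd \<open>n\<close>, because then \<open>-1\<close> is not an \<open>n\<close>-th root
  of unity. The quotient of the two is the product of the theorem when \<open>a = 3\<close>, so each factor has
  the product of the others as its inverse, and this is again an algebraic integer: if \<open>x\<close> and \<open>y\<close>
  are roots of monic integer polynomials of degrees \<open>d\<close> and \<open>e\<close>, then the subgroup generated by all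
  \<open>x ^ i * y ^ j\<close> with \<open>i < d\<close> and \<open>j < e\<close> is mapped into itself by multiplication with \<open>x + y\<close>
  and \<open>x * y\<close>, which are therefore eigenvalues of integer matrices.
\<close>

lemma bij_betw_nat_remainders_mult:
  fixes a n :: nat
  assumes "Rings.coprime a n"
  shows "bij_betw (\<lambda>m. a * m mod n) {1..<n} {1..<n}"
proof -
  have embed: "bij_betw int {1..<n} (int ` {1..<n})"
    by (simp add: bij_betw_def)
  have "bij_betw (\<lambda>m. int a * m mod int n) (int ` {1..<n}) (int ` {1..<n})"
    using bij_betw_int_remainders_mult[of "int a" "int n"] assms
    by (simp add: image_int_atLeastLessThan)
  then have "bij_betw ((\<lambda>m. int a * m mod int n) \<circ> int) {1..<n} (int ` {1..<n})"
    by (rule bij_betw_trans[OF embed])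
  then have "bij_betw (int \<circ> (\<lambda>m. a * m mod n)) {1..<n} (int ` {1..<n})"
    by (simp add: comp_def zmod_int)
  then show ?thesis
    by (auto simp: bij_betw_def image_comp[symmetric] inj_image_eq_iff simp del: o_apply dest: inj_on_imageI2)
qed

lemma power_mod_root_of_unity:
  fixes z :: "'a :: monoid_mult"
  assumes "z ^ n = 1"
  shows "z ^ (m mod n) = z ^ m"
proof -
  have "z ^ m = z ^ (n * (m div n) + m mod n)"
    by simp
  also have "\<dots> = z ^ (m mod n)"
    by (simp only: power_add power_mult assms power_one mult_1)
  finally show ?thesis
    by simp
qed

lemma prod_powers_root_of_unity_mult:
  fixes z :: "'a :: monoid_mult" and f :: "'a \<Rightarrow> 'b :: comm_monoid_mult"
  assumes "z ^ n = 1" and "Rings.coprime a n"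
  shows "(\<Prod>k = 1..<n. f (z ^ (a * k))) = (\<Prod>k = 1..<n. f (z ^ k))"
proof -
  have "(\<Prod>k = 1..<n. f (z ^ (a * k))) = (\<Prod>k = 1..<n. f (z ^ (a * k mod n)))"
    by (simp only: power_mod_root_of_unity[OF assms(1)])
  also have "\<dots> = (\<Prod>k = 1..<n. f (z ^ k))"
    using bij_betw_nat_remainders_mult[OF assms(2)] by (rule prod.reindex_bij_betw)
  finally show ?thesis .
qed

lemma one_plus_root_of_unity_neq_0_if_odd:
  fixes x :: "'a :: ring_char_0"
  assumes "x ^ n = 1" and "odd n"
  shows "1 + x \<noteq> 0"
proof
  assume "1 + x = 0"
  then have "x = - 1"
    by (simp add: add_eq_0_iff)
  then show False
    using assms by simp
qed

lemma prod_alternating_geometric_sum_root_of_unity: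
  fixes z :: "'a :: {idom, ring_char_0}"
  assumes root: "z ^ n = 1" and "odd n" and "odd a" and "Rings.coprime a n"
  shows "(\<Prod>k = 1..<n. \<Sum>i<a. (- (z ^ k)) ^ i) = 1"
proof -
  have "(z ^ k) ^ n = (z ^ n) ^ k" for k
    by (simp add: mult.commute flip: power_mult)
  then have nonzero: "(\<Prod>k = 1..<n. 1 + z ^ k) \<noteq> 0"
    using root \<open>odd n\<close> by (simp add: one_plus_root_of_unity_neq_0_if_odd[where n = n])
  have "(1 + z ^ k) * (\<Sum>i<a. (- (z ^ k)) ^ i) = 1 + z ^ (a * k)" for k
    using one_diff_power_eq[of "- (z ^ k)" a] \<open>odd a\<close>
    by (simp add: power_mult[symmetric] mult.commute)
  then have "(\<Prod>k = 1..<n. 1 + z ^ k) * (\<Prod>k = 1..<n. \<Sum>i<a. (- (z ^ k)) ^ i)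
      = (\<Prod>k = 1..<n. 1 + z ^ (a * k))"
    by (simp add: prod.distrib[symmetric])
  also have "\<dots> = (\<Prod>k = 1..<n. 1 + z ^ k)"
    using root \<open>Rings.coprime a n\<close> by (rule prod_powers_root_of_unity_mult)
  finally show ?thesis
    using nonzero by simp
qed

global_interpretation int_module: Modules.module "\<lambda>(m :: int) (x :: 'a :: ring_1). of_int m * x"
  defines int_span = int_module.span
  by unfold_locales (simp_all add: algebra_simps)

lemma algebraic_int_eigenvalue:
  fixes A :: "int mat" and x :: "'a :: field"
  assumes "A \<in> carrier_mat n n" and "eigenvalue (map_mat of_int A) x"
  shows "algebraic_int x"
proof
  let ?p = "char_poly (map_mat of_int A) :: 'a poly"
  have A: "(map_mat of_int A :: 'a mat) \<in> carrier_mat n n"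
    using assms(1) by simp
  show "poly ?p x = 0"
    using eigenvalue_root_char_poly[OF A] assms(2) by simp
  show "lead_coeff ?p = 1"
    using degree_monic_char_poly[OF A] by simp
  show "\<forall>i. Polynomial.coeff ?p i \<in> \<int>"
    by (simp add: of_int_hom.char_poly_hom[OF assms(1)])
qed

lemma algebraic_int_if_integral_linear_system:
  fixes x :: "'a :: field" and c :: "nat \<Rightarrow> nat \<Rightarrow> int"
  assumes system: "\<And>i. i < n \<Longrightarrow> x * v i = (\<Sum>j<n. of_int (c i j) * v j)"
    and nontrivial: "k < n" "v k \<noteq> 0"
  shows "algebraic_int x"
proof (rule algebraic_int_eigenvalue)
  let ?A = "mat n n (\<lambda>(i, j). c i j)" and ?w = "Matrix.vec n v"
  show A: "?A \<in> carrier_mat n n"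
    by simp
  have "map_mat of_int ?A *\<^sub>v ?w = x \<cdot>\<^sub>v ?w"
    by (rule eq_vecI) (simp_all add: system scalar_prod_def lessThan_atLeast0)
  moreover have "?w \<noteq> 0\<^sub>v n"
    using nontrivial by (auto simp: vec_eq_iff)
  ultimately show "eigenvalue (map_mat of_int ?A) x"
    using A by (auto simp: eigenvalue_def eigenvector_def intro!: exI[of _ ?w])
qed

lemma algebraic_int_if_stabilizes_int_span:
  fixes x :: "'a :: field"
  assumes "finite S" and "s\<^sub>0 \<in> S" "s\<^sub>0 \<noteq> 0" and "\<And>s. s \<in> S \<Longrightarrow> x * s \<in> int_span S"
  shows "algebraic_int x"
proof -
  obtain v where v: "bij_betw v {..<card S} S"
    using ex_bij_betw_nat_finite[OF assms(1)] by (auto simp: lessThan_atLeast0)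
  have "\<forall>s\<in>S. \<exists>c. x * s = (\<Sum>t\<in>S. of_int (c t) * t)"
    using assms(1,4) by (auto simp: int_module.span_finite)
  then obtain c where c: "\<And>s. s \<in> S \<Longrightarrow> x * s = (\<Sum>t\<in>S. of_int (c s t) * t)"
    by metis
  have system: "x * v i = (\<Sum>j<card S. of_int (c (v i) (v j)) * v j)" if "i < card S" for i
    using c[of "v i"] v that by (simp add: bij_betw_apply sum.reindex_bij_betw[OF v, symmetric])
  obtain k where k: "k < card S" "v k = s\<^sub>0"
    using v assms(2) by (metis bij_betw_iff_bijections lessThan_iff)
  show ?thesis
    using system k(1) by (rule algebraic_int_if_integral_linear_system) (simp_all add: k assms(3))
qed

lemma int_span_mult_right:
  fixes a b :: "'a :: ring_1"
  assumes "a \<in> int_span A"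
  shows "a * b \<in> int_span ((\<lambda>a. a * b) ` A)"
  using assms
proof (induction rule: int_module.span_induct_alt)
  case base
  then show ?case
    by (simp add: int_module.span_zero)
next
  case (step c x y)
  then show ?case
    by (simp add: distrib_right mult.assoc int_module.span_add int_module.span_scale int_module.span_base)
qed

lemma mult_in_int_span_if_stabilizes:
  fixes x :: "'a :: comm_ring_1"
  assumes "\<And>s. s \<in> S \<Longrightarrow> x * s \<in> int_span S" and "t \<in> int_span S"
  shows "x * t \<in> int_span S"
proof -
  have "t * x \<in> int_span ((\<lambda>s. s * x) ` S)"
    using assms(2) by (rule int_span_mult_right)
  also have "\<dots> \<subseteq> int_span S"
    using assms(1) by (intro int_module.span_minimal int_module.subspace_span) (auto simp: mult.commute)
  finally show ?thesis
    by (simp add: mult.commute)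
qed

lemma algebraic_int_power_in_int_span:
  fixes x :: "'a :: field"
  assumes "algebraic_int x"
  obtains n where "n > 0" and "x ^ n \<in> int_span ((^) x ` {..<n})"
proof -
  obtain p where monic: "lead_coeff p = 1" and int: "\<forall>i. Polynomial.coeff p i \<in> \<int>"
    and root: "poly p x = 0"
    using assms by (auto elim: algebraic_int.cases)
  have "Polynomial.degree p > 0"
  proof (rule ccontr)
    assume "\<not> Polynomial.degree p > 0"
    then show False
      using monic root by (auto elim: degree_eq_zeroE)
  qed
  have "x ^ Polynomial.degree p = - (\<Sum>i<Polynomial.degree p. Polynomial.coeff p i * x ^ i)"
    using root monic
    by (simp add: poly_altdef eq_neg_iff_add_eq_0 add.commute flip: lessThan_Suc_atMost)
  also have "\<dots> \<in> int_span ((^) x ` {..<Polynomial.degree p})"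
  proof (intro int_module.span_neg int_module.span_sum)
    fix i assume "i \<in> {..<Polynomial.degree p}"
    then show "Polynomial.coeff p i * x ^ i \<in> int_span ((^) x ` {..<Polynomial.degree p})"
      using int by (metis Ints_cases imageI int_module.span_base int_module.span_scale)
  qed
  finally show ?thesis
    using that \<open>Polynomial.degree p > 0\<close> by blast
qed

lemma stabilizes_int_span_powers_mult:
  fixes x :: "'a :: comm_ring_1"
  assumes "x ^ m \<in> int_span ((^) x ` {..<m})"
    and "s \<in> (\<lambda>(i, t). x ^ i * t) ` ({..<m} \<times> T)"
  shows "x * s \<in> int_span ((\<lambda>(i, t). x ^ i * t) ` ({..<m} \<times> T))" (is "_ \<in> int_span ?S")
proof -
  obtain i t where s: "s = x ^ i * t" and "i < m" "t \<in> T"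
    using assms(2) by auto
  consider (lower) "Suc i < m" | (top) "Suc i = m"
    using \<open>i < m\<close> by linarith
  then show ?thesis
  proof cases
    case lower
    then have "x ^ Suc i * t \<in> ?S"
      using \<open>t \<in> T\<close> by force
    then show ?thesis
      by (simp add: s mult.assoc int_module.span_base)
  next
    case top
    have "x ^ m * t \<in> int_span ((\<lambda>a. a * t) ` (^) x ` {..<m})"
      using assms(1) by (rule int_span_mult_right)
    also have "\<dots> \<subseteq> int_span ?S"
      using \<open>t \<in> T\<close> by (intro int_module.span_mono) auto
    finally show ?thesis
      using top by (auto simp: s mult.assoc)
  qed
qed

lemma algebraic_ints_stabilize_int_span:
  fixes x y :: "'a :: field"
  assumes "algebraic_int x" and "algebraic_int y"
  obtains S where "finite S" and "1 \<in> S"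
    and "\<And>s. s \<in> int_span S \<Longrightarrow> x * s \<in> int_span S"
    and "\<And>s. s \<in> int_span S \<Longrightarrow> y * s \<in> int_span S"
proof -
  obtain m where "m > 0" and x: "x ^ m \<in> int_span ((^) x ` {..<m})"
    using assms(1) by (rule algebraic_int_power_in_int_span)
  obtain n where "n > 0" and y: "y ^ n \<in> int_span ((^) y ` {..<n})"
    using assms(2) by (rule algebraic_int_power_in_int_span)
  define S where "S = (\<lambda>(i, t). x ^ i * t) ` ({..<m} \<times> (^) y ` {..<n})"
  have S_commute: "S = (\<lambda>(j, t). y ^ j * t) ` ({..<n} \<times> (^) x ` {..<m})"
    by (force simp: S_def mult.commute)
  show thesis
  proof
    show "finite S"
      by (simp add: S_def)
    show "1 \<in> S"
      using \<open>m > 0\<close> \<open>n > 0\<close> by (force simp: S_def)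
    show "x * s \<in> int_span S" if "s \<in> int_span S" for s
      using stabilizes_int_span_powers_mult[OF x] that unfolding S_def
      by (rule mult_in_int_span_if_stabilizes)
    show "y * s \<in> int_span S" if "s \<in> int_span S" for s
      using stabilizes_int_span_powers_mult[OF y] that unfolding S_commute
      by (rule mult_in_int_span_if_stabilizes)
  qed
qed

lemma
  fixes x y :: "'a :: field"
  assumes "algebraic_int x" and "algebraic_int y"
  shows algebraic_int_plus: "algebraic_int (x + y)"
    and algebraic_int_times: "algebraic_int (x * y)"
proof -
  obtain S where S: "finite S" "1 \<in> S"
    and x: "\<And>s. s \<in> int_span S \<Longrightarrow> x * s \<in> int_span S"
    and y: "\<And>s. s \<in> int_span S \<Longrightarrow> y * s \<in> int_span S"
    using algebraic_ints_stabilize_int_span[OF assms] by blast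
  show "algebraic_int (x + y)"
    using S by (rule algebraic_int_if_stabilizes_int_span)
      (simp_all add: distrib_right x y int_module.span_add int_module.span_base)
  show "algebraic_int (x * y)"
    using S by (rule algebraic_int_if_stabilizes_int_span)
      (simp_all add: mult.assoc x y int_module.span_base)
qed

lemma algebraic_int_diff:
  fixes x y :: "'a :: field"
  assumes "algebraic_int x" and "algebraic_int y"
  shows "algebraic_int (x - y)"
  using algebraic_int_plus[OF assms(1) algebraic_int_minus[OF assms(2)]] by simp

lemma algebraic_int_power:
  fixes x :: "'a :: field"
  assumes "algebraic_int x"
  shows "algebraic_int (x ^ k)"
  using assms by (induction k) (auto intro: algebraic_int_times)

lemma algebraic_int_prod:
  fixes f :: "'b \<Rightarrow> 'a :: field"
  assumes "\<And>i. i \<in> I \<Longrightarrow> algebraic_int (f i)"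
  shows "algebraic_int (\<Prod>i\<in>I. f i)"
  using assms by (induction I rule: infinite_finite_induct) (auto intro: algebraic_int_times)

lemma algebraic_int_root_of_unity:
  fixes z :: "'a :: field"
  assumes "z ^ n = 1" and "n > 0"
  shows "algebraic_int z"
  by (rule algebraic_int_root[of 1 "Polynomial.monom 1 n"])
    (use assms in \<open>simp_all add: poly_monom degree_monom_eq\<close>)

lemma subfield_rat_adjoin: "subfield (rat_adjoin z) cring_class_ops"
  unfolding rat_adjoin_def
  by (rule field.generate_field_is_subfield[OF field_class]) (simp add: carrier_class subset_iff)

lemma generator_in_rat_adjoin: "z \<in> rat_adjoin z"
  unfolding rat_adjoin_def by (rule generate_field.incl) simp

lemma
  fixes K :: "'a :: field set"
  assumes "subfield K cring_class_ops"
  shows subfield_class_one: "1 \<in> K"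
    and subfield_class_plus: "\<And>x y. x \<in> K \<Longrightarrow> y \<in> K \<Longrightarrow> x + y \<in> K"
    and subfield_class_diff: "\<And>x y. x \<in> K \<Longrightarrow> y \<in> K \<Longrightarrow> x - y \<in> K"
    and subfield_class_power: "\<And>x k. x \<in> K \<Longrightarrow> x ^ k \<in> K"
    and subfield_class_inverse: "\<And>x. x \<in> K \<Longrightarrow> x \<noteq> 0 \<Longrightarrow> inverse x \<in> K"
proof -
  note subring_closed = subringE(3,5,6,7)[OF subfieldE(1)[OF assms], unfolded class_simps]
  show one: "1 \<in> K"
    by (rule subring_closed)
  show "x + y \<in> K" if "x \<in> K" "y \<in> K" for x y
    using that by (rule subring_closed)
  show "x - y \<in> K" if "x \<in> K" "y \<in> K" for x y
    using that subring_closed(2,4) by (metis add_uminus_conv_diff)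
  show "x ^ k \<in> K" if "x \<in> K" for x k
    using that by (induction k) (simp_all add: subring_closed)
  show "inverse x \<in> K" if "x \<in> K" "x \<noteq> 0" for x
    using ring.subfield_m_inv_simprule[OF cring.axioms(1)[OF cring_class] assms, of x "inverse x"] that one
    by (simp add: class_simps)
qed

lemma Units_ring_of_integers_iff:
  assumes "subfield K cring_class_ops"
  shows "u \<in> Units (ring_of_integers K) \<longleftrightarrow>
    u \<in> K \<and> u \<noteq> 0 \<and> algebraic_int u \<and> algebraic_int (inverse u)"
proof
  assume "u \<in> Units (ring_of_integers K)"
  then obtain v where "u \<in> K" "algebraic_int u" "algebraic_int v" "u * v = 1"
    by (auto simp: Units_def ring_of_integers_def cring_class_ops_def)
  then show "u \<in> K \<and> u \<noteq> 0 \<and> algebraic_int u \<and> algebraic_int (inverse u)"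
    using inverse_unique by fastforce
next
  assume "u \<in> K \<and> u \<noteq> 0 \<and> algebraic_int u \<and> algebraic_int (inverse u)"
  then show "u \<in> Units (ring_of_integers K)"
    using subfield_class_inverse[OF assms, of u]
    by (auto simp: Units_def ring_of_integers_def cring_class_ops_def intro!: bexI[of _ "inverse u"])
qed

lemma prod_eq_1_imp_Units_ring_of_integers:
  fixes f :: "'i \<Rightarrow> complex"
  assumes "subfield K cring_class_ops" and "f i \<in> K" and "\<And>j. j \<in> I \<Longrightarrow> algebraic_int (f j)"
    and "(\<Prod>j\<in>I. f j) = 1" and "finite I" and "i \<in> I"
  shows "f i \<in> Units (ring_of_integers K)"
proof -
  have "f i * (\<Prod>j\<in>I - {i}. f j) = 1"
    using assms(4-6) by (simp add: prod.remove)
  then have "f i \<noteq> 0" and "inverse (f i) = (\<Prod>j\<in>I - {i}. f j)"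
    by (auto intro: inverse_unique)
  moreover have "algebraic_int (\<Prod>j\<in>I - {i}. f j)"
    using assms(3) by (auto intro: algebraic_int_prod)
  ultimately show ?thesis
    using assms(1-3,6) by (simp add: Units_ring_of_integers_iff)
qed

theorem theorem1:
  fixes n :: nat and \<zeta> :: complex
  assumes "n > 4" and "\<not> 2 dvd n" and "\<not> 3 dvd n"
    and "\<zeta> = exp (2 * \<i> * complex_of_real pi / of_nat n)"
  shows "(\<Prod>k = 1..n - 1. 1 - \<zeta> ^ k + \<zeta> ^ (2 * k)) = 1 \<and>
    1 - \<zeta> + \<zeta>\<^sup>2 \<in> Units (ring_of_integers (rat_adjoin \<zeta>))"
proof
  let ?f = "\<lambda>k. 1 - \<zeta> ^ k + \<zeta> ^ (2 * k)"
  have root: "\<zeta> ^ n = 1"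
    using assms(1) complex_root_unity[of n 1] by (simp add: assms(4) mult_ac)
  have "?f k = (\<Sum>i<3. (- (\<zeta> ^ k)) ^ i)" for k
    by (simp add: eval_nat_numeral power_add mult_2)
  moreover have "Rings.coprime 3 n"
    using assms(3) by (simp add: prime_imp_coprime)
  moreover have "{1..n - 1} = {1..<n}"
    using assms(1) by auto
  ultimately show prod: "(\<Prod>k = 1..n - 1. ?f k) = 1"
    using prod_alternating_geometric_sum_root_of_unity[OF root assms(2), of 3] by simp
  have "algebraic_int (?f k)" for k
    using assms(1) algebraic_int_root_of_unity[OF root]
    by (intro algebraic_int_plus algebraic_int_diff algebraic_int_power) simp_all
  moreover have "?f 1 \<in> rat_adjoin \<zeta>"
    using subfield_rat_adjoin[of \<zeta>] generator_in_rat_adjoin[of \<zeta>]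
    by (intro subfield_class_plus subfield_class_diff subfield_class_power subfield_class_one)
  ultimately have "?f 1 \<in> Units (ring_of_integers (rat_adjoin \<zeta>))"
    using assms(1) prod
    by (intro prod_eq_1_imp_Units_ring_of_integers[of _ ?f 1 "{1..n - 1}"] subfield_rat_adjoin) simp_all
  then show "1 - \<zeta> + \<zeta>\<^sup>2 \<in> Units (ring_of_integers (rat_adjoin \<zeta>))"
    by simp
qed

end
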